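(* For $n\geq 3$, $a_n(132;231) = 2F_n - 2$, where $F_n$ is the $n$-th Fibonacci number.
   Context: Fibonacci numbers: $F_1=F_2=1$, $F_n=F_{n-1}+F_{n-2}$. $\mathcal{S}_n$ is the set of permutations of $[n]=\{1,\dots,n\}$, written in one-line notation $\pi=\pi_1\pi_2\cdots\pi_n$ with $\pi_i=\pi(i)$. A permutation is cyclic if it consists of exactly one $n$-cycle. For a cyclic $\pi$, its standard cycle notation is $C(\pi)=(c_1,c_2,\dots,c_n)$ with $c_1=1$ and $c_i=\pi_{c_{i-1}}$ for $2\le i\le n$. A sequence of distinct integers $w_1\cdots w_m$ contains a pattern $\sigma\in\mathcal{S}_k$ if there are indices $i_1<\dots<i_k$ with $w_{i_1}\cdots w_{i_k}$ in the same relative order as $\sigma_1\cdots\sigma_k$; otherwise it avoids $\sigma$. For $\sigma,\tau\in\mathcal{S}_3$, $\mathcal{A}_n(\sigma;\tau)$ is the set of cyclic permutations $\pi\in\mathcal{S}_n$ whose one-line notation avoids $\sigma$ and whose cycle notation $C(\pi)$ (as the sequence $c_1c_2\cdots c_n$) avoids $\tau$; $a_n(\sigma;\tau)=|\mathcal{A}_n(\sigma;\tau)|$. *)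

theory Defs
  imports "HOL-Combinatorics.Orbits" "HOL-Number_Theory.Fib"
begin

definition one_line :: "nat \<Rightarrow> (nat \<Rightarrow> nat) \<Rightarrow> nat list" where
  "one_line n p = map p [1..<n + 1]"

text \<open>
  The standard cycle notation \<open>c\<^sub>1 = 1, c\<^sub>i = p c\<^sub>i\<^sub>-\<^sub>1\<close>. The list is 0-indexed, so its entry at
  index \<open>i\<close> is \<open>c\<^sub>i\<^sub>+\<^sub>1\<close>. It is meaningful only if \<open>p\<close> is an \<open>n\<close>-cycle on \<open>{1..n}\<close>.
\<close>

definition cycle_notation :: "nat \<Rightarrow> (nat \<Rightarrow> nat) \<Rightarrow> nat list" where
  "cycle_notation n p = map (\<lambda>i. (p ^^ i) 1) [0..<n]"

text \<open>
  Patterns are given by their one-line notation; \<open>f\<close> is the choice of positions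
  \<open>i\<^sub>1 < \<dots> < i\<^sub>k\<close> at which the pattern \<open>s\<close> occurs in \<open>w\<close>.
\<close>

definition contains_pattern :: "nat list \<Rightarrow> nat list \<Rightarrow> bool" where
  "contains_pattern w s \<longleftrightarrow>
     (\<exists>f :: nat \<Rightarrow> nat.
        strict_mono_on {..<length s} f \<and>
        (\<forall>a<length s. f a < length w) \<and>
        (\<forall>a<length s. \<forall>b<length s. w ! f a < w ! f b \<longleftrightarrow> s ! a < s ! b))"

abbreviation avoids_pattern :: "nat list \<Rightarrow> nat list \<Rightarrow> bool" where
  "avoids_pattern w s \<equiv> \<not> contains_pattern w s"

definition cyclic_avoiders :: "nat \<Rightarrow> nat list \<Rightarrow> nat list \<Rightarrow> (nat \<Rightarrow> nat) set" where
  "cyclic_avoiders n s t =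
     {p. p permutes {1..n} \<and> cyclic_on p {1..n} \<and>
         avoids_pattern (one_line n p) s \<and> avoids_pattern (cycle_notation n p) t}"

definition num_cyclic_avoiders :: "nat \<Rightarrow> nat list \<Rightarrow> nat list \<Rightarrow> nat" where
  "num_cyclic_avoiders n s t = card (cyclic_avoiders n s t)"

end

theory Submission
  imports Defs "HOL-Combinatorics.Cycles"
begin

text \<open>
  A cyclic permutation is read as the closed path through its cycle notation \<open>c\<close>, so that its graph is
  the set of edges of \<open>c @ [1]\<close> and deleting or relabelling an entry of \<open>c\<close> is harmless.
  Write \<open>c = 1 A n B\<close>. Avoiding 231 in \<open>c\<close> puts \<open>A\<close> below \<open>B\<close>; if both were nonempty,
  the edges leaving \<open>1\<close>, entering \<open>n\<close> and leaving \<open>n\<close> would form a 132 in the one-line notation. Hence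
  \<open>c = 1 A n\<close> or \<open>c = 1 n B\<close>. The same argument at the entry \<open>n - 1\<close> shows that \<open>A\<close> ends or begins with
  \<open>n - 1\<close>, and likewise \<open>B\<close>. Deleting \<open>n - 1\<close> leads in one case to size \<open>n - 1\<close>, in the other to
  a path between two ends that are both larger than everything in between. Such a path either descends
  through all values or starts with 2, and then deleting its source gives size \<open>n - 2\<close>.
  So both families have \<open>x\<^sub>n\<close> elements with \<open>x\<^sub>n = x\<^sub>n\<^sub>-\<^sub>1 + x\<^sub>n\<^sub>-\<^sub>2 + 1\<close>.
\<close>

section \<open>Encodings of the two avoidance conditions\<close>

fun before_pairs :: "'a list \<Rightarrow> ('a \<times> 'a) set" where
  "before_pairs [] = {}"
| "before_pairs (x # xs) = {x} \<times> set xs \<union> before_pairs xs"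

text \<open>On lists with repeated entries this is stronger than avoiding the pattern 231.\<close>

definition avoids_231 :: "nat list \<Rightarrow> bool" where
  "avoids_231 w \<longleftrightarrow>
     (\<forall>a b c. (a, b) \<in> before_pairs w \<longrightarrow> (b, c) \<in> before_pairs w \<longrightarrow> \<not> (c < a \<and> a < b))"

fun path_edges :: "'a list \<Rightarrow> ('a \<times> 'a) set" where
  "path_edges (x # y # xs) = insert (x, y) (path_edges (y # xs))"
| "path_edges _ = {}"

text \<open>A relation instead of a one-line word: sources play the role of positions, so the
  condition makes sense for any part of the graph of a permutation and survives the deletion of
  edges.\<close>

definition avoids_132 :: "(nat \<times> nat) set \<Rightarrow> bool" where
  "avoids_132 R \<longleftrightarrow>
     (\<forall>x1 y1 x2 y2 x3 y3. (x1, y1) \<in> R \<longrightarrow> (x2, y2) \<in> R \<longrightarrow> (x3, y3) \<in> R \<longrightarrow>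
        x1 < x2 \<longrightarrow> x2 < x3 \<longrightarrow> \<not> (y1 < y3 \<and> y3 < y2))"

section \<open>Avoidance of 231 in words\<close>

lemma before_pairs_append:
  "before_pairs (xs @ ys) = before_pairs xs \<union> before_pairs ys \<union> set xs \<times> set ys"
  by (induction xs) auto

lemma before_pairs_in_set: "(x, y) \<in> before_pairs xs \<Longrightarrow> x \<in> set xs \<and> y \<in> set xs"
  by (induction xs) auto

lemma before_pairs_map: "before_pairs (map f xs) = map_prod f f ` before_pairs xs"
  by (induction xs) auto

lemma before_pairs_conv_nth:
  "before_pairs xs = {(xs ! i, xs ! j) | i j. i < j \<and> j < length xs}"
proof (induction xs)
  case (Cons x xs)
  have "(a, b) \<in> before_pairs (x # xs) \<longleftrightarrow>
      (\<exists>i j. a = (x # xs) ! i \<and> b = (x # xs) ! j \<and> i < j \<and> j < length (x # xs))" (is "?L \<longleftrightarrow> ?R")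
    for a b
  proof
    assume ?L
    then consider j where "a = x" "b = xs ! j" "j < length xs"
      | i j where "a = xs ! i" "b = xs ! j" "i < j" "j < length xs"
      unfolding before_pairs.simps Cons.IH by (auto simp: in_set_conv_nth)
    then show ?R
    proof cases
      case (1 j)
      then show ?thesis by (intro exI[of _ 0] exI[of _ "Suc j"]) simp
    next
      case (2 i j)
      then show ?thesis by (intro exI[of _ "Suc i"] exI[of _ "Suc j"]) simp
    qed
  next
    assume ?R
    then obtain i j where ij: "a = (x # xs) ! i" "b = (x # xs) ! j" "i < j" "j < length (x # xs)"
      by blast
    then obtain j' where j: "j = Suc j'" by (cases j) simp_all
    show ?L
    proof (cases i)
      case 0
      then show ?thesis using ij j by simp
    next
      case (Suc i')
      have "(xs ! i', xs ! j') \<in> before_pairs xs"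
        unfolding Cons.IH using ij j Suc by auto
      then show ?thesis using ij j Suc by simp
    qed
  qed
  then have "p \<in> before_pairs (x # xs) \<longleftrightarrow>
      p \<in> {((x # xs) ! i, (x # xs) ! j) | i j. i < j \<and> j < length (x # xs)}" for p
    by (cases p) (simp only: mem_Collect_eq prod.inject, blast)
  then show ?case by (rule set_eqI)
qed simp

lemma avoids_231_mono: "avoids_231 w \<Longrightarrow> before_pairs v \<subseteq> before_pairs w \<Longrightarrow> avoids_231 v"
  unfolding avoids_231_def by blast

text \<open>An entry in first place could only be the 2 of a 231, and then needs both a larger and a
  smaller entry after it.\<close>

lemma avoids_231_Cons:
  assumes av: "avoids_231 xs" and x: "x \<notin> set xs"
    and ext: "(\<forall>y\<in>set xs. x \<le> y) \<or> (\<forall>y\<in>set xs. y \<le> x)"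
  shows "avoids_231 (x # xs)"
  unfolding avoids_231_def
proof (intro allI impI)
  fix a b c assume ab: "(a, b) \<in> before_pairs (x # xs)" and bc: "(b, c) \<in> before_pairs (x # xs)"
  have b: "b \<in> set xs" using ab before_pairs_in_set[of a b xs] by auto
  then have bc': "(b, c) \<in> before_pairs xs" using bc x by auto
  then have c: "c \<in> set xs" using before_pairs_in_set by fast
  show "\<not> (c < a \<and> a < b)"
  proof (cases "a = x")
    case True
    then show ?thesis using ext b c by force
  next
    case False
    then have "(a, b) \<in> before_pairs xs" using ab by simp
    then show ?thesis using av bc' unfolding avoids_231_def by blast
  qed
qed

text \<open>An entry in last place could only be the 1 of a 231, and then has to lie below earlier
  entries.\<close>

lemma avoids_231_snoc:
  assumes av: "avoids_231 xs" and x: "x \<notin> set xs" and ext: "\<forall>y\<in>set xs. y \<le> x"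
  shows "avoids_231 (xs @ [x])"
  unfolding avoids_231_def
proof (intro allI impI)
  fix a b c assume ab: "(a, b) \<in> before_pairs (xs @ [x])" and bc: "(b, c) \<in> before_pairs (xs @ [x])"
  have a: "a \<in> set xs" using ab before_pairs_in_set[of a b xs] by (auto simp: before_pairs_append)
  have b: "b \<in> set xs" using bc before_pairs_in_set[of b c xs] by (auto simp: before_pairs_append)
  then have ab': "(a, b) \<in> before_pairs xs" using ab x by (auto simp: before_pairs_append)
  show "\<not> (c < a \<and> a < b)"
  proof (cases "c = x")
    case True
    then show ?thesis using ext a by force
  next
    case False
    then have "(b, c) \<in> before_pairs xs" using bc by (simp add: before_pairs_append)
    then show ?thesis using av ab' unfolding avoids_231_def by blast
  qed
qed

lemma avoids_231_map_strict_mono: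
  assumes "strict_mono f"
  shows "avoids_231 (map f xs) \<longleftrightarrow> avoids_231 xs"
proof
  assume av: "avoids_231 (map f xs)"
  have im: "(f x, f y) \<in> before_pairs (map f xs)" if "(x, y) \<in> before_pairs xs" for x y
    unfolding before_pairs_map using that by (rule map_prod_imageI)
  show "avoids_231 xs"
    unfolding avoids_231_def
  proof (intro allI impI)
    fix a b c assume "(a, b) \<in> before_pairs xs" "(b, c) \<in> before_pairs xs"
    from this[THEN im] have "\<not> (f c < f a \<and> f a < f b)"
      using av unfolding avoids_231_def by blast
    then show "\<not> (c < a \<and> a < b)" by (simp add: strict_mono_less[OF assms])
  qed
next
  assume av: "avoids_231 xs"
  show "avoids_231 (map f xs)"
    unfolding avoids_231_def
  proof (intro allI impI)
    fix a b c assume *: "(a, b) \<in> before_pairs (map f xs)" "(b, c) \<in> before_pairs (map f xs)"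
    then obtain x y y' z where xyz: "(x, y) \<in> before_pairs xs" "(y', z) \<in> before_pairs xs"
      "a = f x" "b = f y" "b = f y'" "c = f z"
      unfolding before_pairs_map by auto
    have "y' = y" using xyz(4,5) strict_mono_eq[OF assms] by simp
    then have "\<not> (z < x \<and> x < y)" using av xyz(1,2) unfolding avoids_231_def by blast
    then show "\<not> (c < a \<and> a < b)" by (simp add: xyz strict_mono_less[OF assms])
  qed
qed

text \<open>In the definition the two pairs share only the value of the middle entry; distinctness
  makes them share its position.\<close>

lemma avoids_231_iff_nth:
  assumes "distinct w"
  shows "avoids_231 w \<longleftrightarrow>
    (\<forall>i j k. i < j \<longrightarrow> j < k \<longrightarrow> k < length w \<longrightarrow> \<not> (w ! k < w ! i \<and> w ! i < w ! j))"
    (is "_ \<longleftrightarrow> ?R")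
proof
  assume w: "avoids_231 w"
  show ?R
  proof (intro allI impI)
    fix i j k assume *: "i < j" "j < k" "k < length w"
    then have "(w ! i, w ! j) \<in> before_pairs w" "(w ! j, w ! k) \<in> before_pairs w"
      unfolding before_pairs_conv_nth by (auto, (metis order.strict_trans)+)
    then show "\<not> (w ! k < w ! i \<and> w ! i < w ! j)"
      using w unfolding avoids_231_def by blast
  qed
next
  assume r: ?R
  show "avoids_231 w" unfolding avoids_231_def
  proof (intro allI impI)
    fix a b c assume "(a, b) \<in> before_pairs w" "(b, c) \<in> before_pairs w"
    then obtain i j j' k where *: "a = w ! i" "b = w ! j" "i < j" "j < length w"
      "b = w ! j'" "c = w ! k" "j' < k" "k < length w"
      unfolding before_pairs_conv_nth by blast
    then have "j = j'" using assms by (simp add: nth_eq_iff_index_eq)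
    then show "\<not> (c < a \<and> a < b)" using * r by blast
  qed
qed

section \<open>Edges of paths and avoidance of 132\<close>

lemma path_edges_append:
  "path_edges (xs @ y # ys) = path_edges (xs @ [y]) \<union> path_edges (y # ys)"
  by (induction xs rule: path_edges.induct) auto

lemma path_edges_in_set:
  "(x, y) \<in> path_edges xs \<Longrightarrow> x \<in> set (butlast xs) \<and> y \<in> set (tl xs)"
  by (induction xs rule: path_edges.induct) auto

lemma path_edges_Cons: "xs \<noteq> [] \<Longrightarrow> path_edges (x # xs) = insert (x, hd xs) (path_edges xs)"
  by (cases xs) auto

lemma path_edges_snoc: "xs \<noteq> [] \<Longrightarrow> path_edges (xs @ [x]) = insert (last xs, x) (path_edges xs)"
  by (induction xs rule: path_edges.induct) auto

lemma path_edges_map: "path_edges (map f xs) = map_prod f f ` path_edges xs"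
  by (induction xs rule: path_edges.induct) auto

lemma path_edges_conv_nth:
  "path_edges xs = {(xs ! i, xs ! Suc i) | i. Suc i < length xs}"
proof (induction xs rule: path_edges.induct)
  case (1 x y xs)
  have ex_Suc: "(\<exists>i. P i) \<longleftrightarrow> P 0 \<or> (\<exists>i. P (Suc i))" for P
    by (metis not0_implies_Suc)
  have "p \<in> path_edges (x # y # xs) \<longleftrightarrow>
      (\<exists>i. p = ((x # y # xs) ! i, (x # y # xs) ! Suc i) \<and> Suc i < length (x # y # xs))" for p
    unfolding path_edges.simps 1
    by (subst ex_Suc[where P = "\<lambda>i. p = ((x # y # xs) ! i, (x # y # xs) ! Suc i) \<and> Suc i < length (x # y # xs)"])
      auto
  then show ?case by blast
qed auto

lemma avoids_132_mono: "avoids_132 S \<Longrightarrow> R \<subseteq> S \<Longrightarrow> avoids_132 R"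
  unfolding avoids_132_def by blast

lemma avoids_132D:
  "avoids_132 R \<Longrightarrow> (x1, y1) \<in> R \<Longrightarrow> (x2, y2) \<in> R \<Longrightarrow> (x3, y3) \<in> R \<Longrightarrow>
    x1 < x2 \<Longrightarrow> x2 < x3 \<Longrightarrow> y1 < y3 \<Longrightarrow> y3 < y2 \<Longrightarrow> False"
  unfolding avoids_132_def by blast

text \<open>The sources in a 132 are distinct, so the new edge occurs at most once; the three
  conditions exclude it as the 1, the 3 and the 2, in this order.\<close>

lemma avoids_132_insert:
  assumes "avoids_132 R"
    and "\<And>x y x' y'. (x, y) \<in> R \<Longrightarrow> (x', y') \<in> R \<Longrightarrow> \<not> (a < x \<and> x < x' \<and> b < y' \<and> y' < y)"
    and "\<And>x y x' y'. (x, y) \<in> R \<Longrightarrow> (x', y') \<in> R \<Longrightarrow> \<not> (x < a \<and> a < x' \<and> y < y' \<and> y' < b)"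
    and "\<And>x y x' y'. (x, y) \<in> R \<Longrightarrow> (x', y') \<in> R \<Longrightarrow> \<not> (x < x' \<and> x' < a \<and> y < b \<and> b < y')"
  shows "avoids_132 (insert (a, b) R)"
  unfolding avoids_132_def
proof (intro allI impI notI)
  fix x1 y1 x2 y2 x3 y3
  assume *: "(x1, y1) \<in> insert (a, b) R" "(x2, y2) \<in> insert (a, b) R" "(x3, y3) \<in> insert (a, b) R"
    "x1 < x2" "x2 < x3" "y1 < y3 \<and> y3 < y2"
  then consider "(x1, y1) \<in> R" "(x2, y2) \<in> R" "(x3, y3) \<in> R"
    | "(x1, y1) = (a, b)" "(x2, y2) \<in> R" "(x3, y3) \<in> R"
    | "(x1, y1) \<in> R" "(x2, y2) = (a, b)" "(x3, y3) \<in> R"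
    | "(x1, y1) \<in> R" "(x2, y2) \<in> R" "(x3, y3) = (a, b)"
    by auto
  then show False
  proof cases
    case 1 then show ?thesis using avoids_132D[OF assms(1)] * by blast
  next
    case 2 then show ?thesis using assms(2) * by blast
  next
    case 3 then show ?thesis using assms(3) * by blast
  next
    case 4 then show ?thesis using assms(4) * by blast
  qed
qed

lemma avoids_132_map_strict_mono:
  assumes "strict_mono f"
  shows "avoids_132 (map_prod f f ` R) \<longleftrightarrow> avoids_132 R"
proof
  assume av: "avoids_132 (map_prod f f ` R)"
  have im: "(f x, f y) \<in> map_prod f f ` R" if "(x, y) \<in> R" for x y
    using that by (rule map_prod_imageI)
  show "avoids_132 R"
    unfolding avoids_132_def
  proof (intro allI impI notI)
    fix x1 y1 x2 y2 x3 y3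
    assume *: "(x1, y1) \<in> R" "(x2, y2) \<in> R" "(x3, y3) \<in> R" "x1 < x2" "x2 < x3" "y1 < y3 \<and> y3 < y2"
    show False
      by (rule avoids_132D[OF av *(1-3)[THEN im]]) (use * in \<open>simp_all add: strict_mono_less[OF assms]\<close>)
  qed
next
  assume av: "avoids_132 R"
  show "avoids_132 (map_prod f f ` R)"
    unfolding avoids_132_def
  proof (intro allI impI notI)
    fix x1 y1 x2 y2 x3 y3
    assume *: "(x1, y1) \<in> map_prod f f ` R" "(x2, y2) \<in> map_prod f f ` R"
      "(x3, y3) \<in> map_prod f f ` R" "x1 < x2" "x2 < x3" "y1 < y3 \<and> y3 < y2"
    from *(1-3) obtain u1 v1 u2 v2 u3 v3 where uv: "(u1, v1) \<in> R" "(u2, v2) \<in> R" "(u3, v3) \<in> R"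
      "x1 = f u1" "y1 = f v1" "x2 = f u2" "y2 = f v2" "x3 = f u3" "y3 = f v3"
      by (elim imageE) (auto simp only: map_prod_def split: prod.splits)
    show False
      by (rule avoids_132D[OF av uv(1-3)]) (use *(4-) uv(4-) in \<open>simp_all add: strict_mono_less[OF assms]\<close>)
  qed
qed

text \<open>The start is compared only with sources and the end only with targets. Both exceed all
  of \<open>A\<close>, so other labels above \<open>A\<close> give the same comparisons in each
  coordinate.\<close>

lemma avoids_132_change_ends:
  assumes av: "avoids_132 (path_edges (s # A @ [t]))"
    and big: "\<forall>x\<in>set A. x < s \<and> x < t \<and> x < s' \<and> x < t'"
  shows "avoids_132 (path_edges (s' # A @ [t']))"
proof (cases "A = []")
  case True
  then show ?thesis by (auto simp: avoids_132_def)
next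
  case False
  have edges: "path_edges (u # A @ [v]) = insert (u, hd A) (insert (last A, v) (path_edges A))"
    for u v using False by (simp add: path_edges_Cons path_edges_snoc)
  \<comment> \<open>\<open>f s s'\<close> acts on sources and \<open>f t t'\<close> on targets,
    turning the new label back into the old one. A single map would not do when \<open>s'\<close>
    and \<open>t'\<close> coincide but \<open>s\<close> and \<open>t\<close> differ.\<close>
  define f where "f u u' x = (if x = u' then u else x)" for u u' x :: nat
  have f_A: "f s s' x = x" "f t t' x = x" if "x \<in> set A" for x
    using that big by (auto simp: f_def)
  have f_ends: "f s s' s' = s" "f t t' t' = t" by (simp_all add: f_def)
  have e: "(f s s' x, f t t' y) \<in> path_edges (s # A @ [t])"
    if xy: "(x, y) \<in> path_edges (s' # A @ [t'])" for x y
  proof -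
    consider "(x, y) = (s', hd A)" | "(x, y) = (last A, t')" | "(x, y) \<in> path_edges A"
      using xy unfolding edges by blast
    then show ?thesis
    proof cases
      case 3
      then have "x \<in> set A" "y \<in> set A"
        using path_edges_in_set[OF 3] False by (auto dest: in_set_butlastD list.set_sel(2))
      then show ?thesis using 3 by (simp add: edges f_A)
    qed (use False in \<open>simp_all add: edges f_A f_ends\<close>)
  qed
  have p: "f s s' x < f s s' y" if "x \<in> set (s' # A)" "y \<in> set (s' # A)" "x < y" for x y
    using that big by (fastforce simp: f_def)
  have q: "f t t' x < f t t' y" if "x \<in> set (t' # A)" "y \<in> set (t' # A)" "x < y" for x y
    using that big by (fastforce simp: f_def)
  have r: "x \<in> set (s' # A) \<and> y \<in> set (t' # A)" if "(x, y) \<in> path_edges (s' # A @ [t'])" for x y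
    using path_edges_in_set[OF that] by (auto simp: butlast_append)
  show ?thesis
    unfolding avoids_132_def
  proof (intro allI impI notI)
    fix x1 y1 x2 y2 x3 y3
    assume *: "(x1, y1) \<in> path_edges (s' # A @ [t'])" "(x2, y2) \<in> path_edges (s' # A @ [t'])"
      "(x3, y3) \<in> path_edges (s' # A @ [t'])" "x1 < x2" "x2 < x3" "y1 < y3 \<and> y3 < y2"
    show False
      by (rule avoids_132D[OF av *(1-3)[THEN e]])
        (use *(4-6) *(1-3)[THEN r] in \<open>simp_all only: p q\<close>)
  qed
qed

section \<open>Word families for the cycle notations\<close>

text \<open>
  The words \<open>A\<close> with \<open>1 A n\<close> (for \<open>up_words\<close>) or \<open>1 n A\<close> (for \<open>down_words\<close>) an admissible cycle; the
  edges \<open>(n, 1)\<close> and \<open>(1, n)\<close> can be dropped because they are part of no 132. In \<open>top_words\<close> the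
  two ends stand for any labels above \<open>A\<close>, by the lemma \<open>avoids_132_change_ends\<close>.
\<close>

definition up_words :: "nat \<Rightarrow> nat list set" where
  "up_words n = {A. distinct A \<and> set A = {2..<n} \<and> avoids_231 A \<and>
     avoids_132 (path_edges (1 # A @ [n]))}"

definition down_words :: "nat \<Rightarrow> nat list set" where
  "down_words n = {A. distinct A \<and> set A = {2..<n} \<and> avoids_231 A \<and>
     avoids_132 (path_edges (n # A @ [1]))}"

definition top_words :: "nat \<Rightarrow> nat list set" where
  "top_words n = {A. distinct A \<and> set A = {2..<n} \<and> avoids_231 A \<and>
     avoids_132 (path_edges (n # A @ [n]))}"

text \<open>The cycle notations of the permutations to be counted, by
  \<open>bij_betw_cycle_notation\<close>.\<close>

definition cycle_words :: "nat \<Rightarrow> nat list set" where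
  "cycle_words n = {c. distinct c \<and> set c = {1..n} \<and> hd c = 1 \<and> avoids_231 c \<and>
     avoids_132 (path_edges (c @ [1]))}"

section \<open>Splitting at the largest entry\<close>

text \<open>With \<open>b < a\<close>, the entries \<open>a\<close>, \<open>m\<close>,
  \<open>b\<close> would form a 231.\<close>

lemma avoids_231_split_max:
  assumes "avoids_231 (A @ m # B)" "distinct (A @ m # B)" "a \<in> set A" "b \<in> set B" "a < m"
  shows "a < b"
proof -
  have "(a, m) \<in> before_pairs (A @ m # B)" "(m, b) \<in> before_pairs (A @ m # B)"
    using assms(3,4) by (auto simp: before_pairs_append)
  then have "\<not> b < a" using assms(1,5) unfolding avoids_231_def by blast
  moreover have "a \<noteq> b" using assms(2-4) by auto
  ultimately show ?thesis by simp
qed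

lemma set_split_max:
  assumes "distinct (A @ n # B)" "set (A @ n # B) = {2..<Suc n}"
  shows "set A \<union> set B = {2..<n}"
proof -
  have "set A \<union> set B = set (A @ n # B) - {n}" using assms(1) by auto
  also have "\<dots> = {2..<n}" unfolding assms(2) by auto
  finally show ?thesis .
qed

text \<open>The sources \<open>x < last A < m\<close> have the targets \<open>hd A\<close>,
  \<open>m\<close>, \<open>hd B\<close>, which form a 132.\<close>

lemma not_avoids_132_split_max:
  assumes "A \<noteq> []" "B \<noteq> []" "\<forall>a\<in>set A. x < a \<and> a < m \<and> a < hd B" "hd B < m"
  shows "\<not> avoids_132 (path_edges (x # A @ m # B))"
proof
  assume av: "avoids_132 (path_edges (x # A @ m # B))"
  have "path_edges (x # A @ m # B) = path_edges (x # A @ [m]) \<union> path_edges (m # B)"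
    using path_edges_append[of "x # A" m B] by simp
  then have "(x, hd A) \<in> path_edges (x # A @ m # B)" "(last A, m) \<in> path_edges (x # A @ m # B)"
    "(m, hd B) \<in> path_edges (x # A @ m # B)"
    using assms(1,2) by (auto simp: path_edges_Cons path_edges_snoc)
  from avoids_132D[OF av this] show False using assms by auto
qed

lemma cycle_words_eq:
  assumes "n \<ge> 3"
  shows "cycle_words n = (\<lambda>A. 1 # A @ [n]) ` up_words n \<union> (\<lambda>A. 1 # n # A) ` down_words n"
    (is "_ = ?R")
proof (intro equalityI subsetI)
  fix c assume "c \<in> cycle_words n"
  then have c: "distinct c" "set c = {1..n}" "hd c = 1" "avoids_231 c"
    "avoids_132 (path_edges (c @ [1]))" by (auto simp: cycle_words_def)
  then obtain c' where c': "c = 1 # c'" using assms by (cases c) auto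
  have "set c' = set c - {1}" using c(1) by (auto simp: c')
  also have "\<dots> = {2..<Suc n}" unfolding c(2)
    by (rule set_eqI, simp only: Diff_iff atLeastAtMost_iff atLeastLessThan_iff singleton_iff, arith)
  finally have set_c': "set c' = {2..<Suc n}" .
  then have "n \<in> set c'" using assms by simp
  then obtain A B where AB: "c' = A @ n # B" by (metis split_list)
  note ceq = c'[unfolded AB]
  have dis': "distinct (A @ n # B)" using c(1) unfolding ceq by simp
  then have sub: "set A \<union> set B = {2..<n}"
    using set_c' unfolding AB by (rule set_split_max)
  have rng: "2 \<le> x \<and> x < n" if "x \<in> set A \<or> x \<in> set B" for x
    using that sub by (metis UnI1 UnI2 atLeastLessThan_iff)
  have dis: "distinct A" "distinct B" "set A \<inter> set B = {}" using c(1) unfolding ceq by auto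
  have path: "path_edges (c @ [1]) = path_edges (1 # A @ [n]) \<union> path_edges (n # B @ [1])"
    unfolding ceq using path_edges_append[of "1 # A" n "B @ [1]"] by simp
  show "c \<in> ?R"
  proof (cases "A = [] \<or> B = []")
    case True
    then show ?thesis
    proof
      assume A: "A = []"
      have "avoids_231 B" by (rule avoids_231_mono[OF c(4)]) (auto simp: ceq before_pairs_append)
      moreover have "avoids_132 (path_edges (n # B @ [1]))"
        by (rule avoids_132_mono[OF c(5)]) (unfold path, blast)
      ultimately show ?thesis using A sub dis by (auto simp: ceq down_words_def)
    next
      assume B: "B = []"
      have "avoids_231 A" by (rule avoids_231_mono[OF c(4)]) (auto simp: ceq before_pairs_append)
      moreover have "avoids_132 (path_edges (1 # A @ [n]))"
        by (rule avoids_132_mono[OF c(5)]) (unfold path, blast)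
      ultimately show ?thesis using B sub dis by (auto simp: ceq up_words_def)
    qed
  next
    case False
    have "hd B \<in> set B" using False by simp
    have "avoids_231 (A @ n # B)" by (rule avoids_231_mono[OF c(4)]) (auto simp: ceq)
    then have "\<forall>a\<in>set A. a < hd B"
      using avoids_231_split_max[OF _ dis' _ \<open>hd B \<in> set B\<close>] rng by blast
    moreover have "hd B < n" "\<forall>a\<in>set A. 1 < a \<and> a < n" using \<open>hd B \<in> set B\<close> rng by force+
    \<comment> \<open>The closing 1 is taken as part of the second block; its head stays
      \<open>hd B\<close> because \<open>B\<close> is nonempty.\<close>
    ultimately have "\<not> avoids_132 (path_edges (1 # A @ n # B @ [1]))"
      using False by (intro not_avoids_132_split_max) auto
    then show ?thesis using c(5) by (simp add: ceq)
  qed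
next
  fix c assume "c \<in> ?R"
  then show "c \<in> cycle_words n"
  proof
    assume "c \<in> (\<lambda>A. 1 # A @ [n]) ` up_words n"
    then obtain A where A: "c = 1 # A @ [n]" "distinct A" "set A = {2..<n}" "avoids_231 A"
      "avoids_132 (path_edges (1 # A @ [n]))" by (auto simp: up_words_def)
    have "avoids_231 c" unfolding A(1) using A assms
      by (intro avoids_231_Cons avoids_231_snoc) auto
    moreover have "path_edges (c @ [1]) = insert (n, 1) (path_edges (1 # A @ [n]))"
      unfolding A(1) using path_edges_append[of "1 # A" n "[1]"] by simp
    \<comment> \<open>\<open>n\<close> is the largest source, so the new edge could only be the 2 of
      a 132, but its target is the smallest.\<close>
    moreover have "avoids_132 (insert (n, 1) (path_edges (1 # A @ [n])))"
      using A(3,5) assms by (intro avoids_132_insert) (auto dest!: path_edges_in_set simp: butlast_append)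
    ultimately show ?thesis using A assms by (auto simp: cycle_words_def)
  next
    assume "c \<in> (\<lambda>A. 1 # n # A) ` down_words n"
    then obtain A where A: "c = 1 # n # A" "distinct A" "set A = {2..<n}" "avoids_231 A"
      "avoids_132 (path_edges (n # A @ [1]))" by (auto simp: down_words_def)
    have "avoids_231 c" unfolding A(1) using A assms
      by (intro avoids_231_Cons) auto
    moreover have "path_edges (c @ [1]) = insert (1, n) (path_edges (n # A @ [1]))"
      unfolding A(1) by simp
    \<comment> \<open>\<open>1\<close> is the smallest source, so the new edge could only be the 1
      of a 132, but its target is the largest.\<close>
    moreover have "avoids_132 (insert (1, n) (path_edges (n # A @ [1])))"
      using A(3,5) assms by (intro avoids_132_insert) (auto dest!: path_edges_in_set simp: butlast_append)
    ultimately show ?thesis using A assms by (auto simp: cycle_words_def)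
  qed
qed

text \<open>If \<open>n\<close> comes last, cutting off the edge \<open>(n, Suc n)\<close> leaves a
  path of the same kind. If it comes first, cutting off \<open>(1, n)\<close> leaves a path from
  \<open>n\<close> to \<open>Suc n\<close>; both ends lie above everything in between, so both may
  be labelled \<open>n\<close>.\<close>

lemma up_words_Suc:
  assumes "n \<ge> 3"
  shows "up_words (Suc n) = (\<lambda>A. A @ [n]) ` up_words n \<union> (\<lambda>A. n # A) ` top_words n"
    (is "_ = ?R")
proof (intro equalityI subsetI)
  fix c assume "c \<in> up_words (Suc n)"
  then have c: "distinct c" "set c = {2..<Suc n}" "avoids_231 c"
    "avoids_132 (path_edges (1 # c @ [Suc n]))" by (auto simp: up_words_def)
  have "n \<in> set c" using c(2) assms by auto
  then obtain A B where ceq: "c = A @ n # B" by (metis split_list)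
  have sub: "set A \<union> set B = {2..<n}"
    using c(1,2) unfolding ceq by (rule set_split_max)
  have rng: "2 \<le> x \<and> x < n" if "x \<in> set A \<or> x \<in> set B" for x
    using that sub by (metis UnI1 UnI2 atLeastLessThan_iff)
  have dis: "distinct A" "distinct B" "set A \<inter> set B = {}" using c(1) unfolding ceq by auto
  have path: "path_edges (1 # c @ [Suc n]) = path_edges (1 # A @ [n]) \<union> path_edges (n # B @ [Suc n])"
    unfolding ceq using path_edges_append[of "1 # A" n "B @ [Suc n]"] by simp
  show "c \<in> ?R"
  proof (cases "A = [] \<or> B = []")
    case True
    then show ?thesis
    proof
      assume A: "A = []"
      have "avoids_231 B" by (rule avoids_231_mono[OF c(3)]) (auto simp: ceq before_pairs_append)
      moreover have "avoids_132 (path_edges (n # B @ [Suc n]))"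
        by (rule avoids_132_mono[OF c(4)]) (unfold path, blast)
      then have "avoids_132 (path_edges (n # B @ [n]))"
        by (rule avoids_132_change_ends) (use rng in force)
      ultimately show ?thesis using A sub dis by (auto simp: ceq top_words_def)
    next
      assume B: "B = []"
      have "avoids_231 A" by (rule avoids_231_mono[OF c(3)]) (auto simp: ceq before_pairs_append)
      moreover have "avoids_132 (path_edges (1 # A @ [n]))"
        by (rule avoids_132_mono[OF c(4)]) (unfold path, blast)
      ultimately show ?thesis using B sub dis by (auto simp: ceq up_words_def)
    qed
  next
    case False
    have "hd B \<in> set B" using False by simp
    then have "\<forall>a\<in>set A. a < hd B"
      using avoids_231_split_max[OF c(3)[unfolded ceq] c(1)[unfolded ceq]] rng by blast
    moreover have "hd B < n" "\<forall>a\<in>set A. 1 < a \<and> a < n" using \<open>hd B \<in> set B\<close> rng by force+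
    ultimately have "\<not> avoids_132 (path_edges (1 # A @ n # B @ [Suc n]))"
      using False by (intro not_avoids_132_split_max) auto
    then show ?thesis using c(4) by (simp add: ceq)
  qed
next
  fix c assume "c \<in> ?R"
  then show "c \<in> up_words (Suc n)"
  proof
    assume "c \<in> (\<lambda>A. A @ [n]) ` up_words n"
    then obtain A where A: "c = A @ [n]" "distinct A" "set A = {2..<n}" "avoids_231 A"
      "avoids_132 (path_edges (1 # A @ [n]))" by (auto simp: up_words_def)
    have "avoids_231 c" unfolding A(1) using A
      by (intro avoids_231_snoc) auto
    moreover have "path_edges (1 # c @ [Suc n]) = insert (n, Suc n) (path_edges (1 # A @ [n]))"
      unfolding A(1) using path_edges_append[of "1 # A" n "[Suc n]"] by simp
    \<comment> \<open>\<open>n\<close> is the largest source, so the new edge could only be the 2 of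
      a 132, but no target exceeds \<open>Suc n\<close>.\<close>
    moreover have "avoids_132 (insert (n, Suc n) (path_edges (1 # A @ [n])))"
      using A(3,5) assms by (intro avoids_132_insert) (auto dest!: path_edges_in_set simp: butlast_append)
    ultimately show ?thesis using A assms by (auto simp: up_words_def)
  next
    assume "c \<in> (\<lambda>A. n # A) ` top_words n"
    then obtain A where A: "c = n # A" "distinct A" "set A = {2..<n}" "avoids_231 A"
      "avoids_132 (path_edges (n # A @ [n]))" by (auto simp: top_words_def)
    have "avoids_231 c" unfolding A(1) using A assms
      by (intro avoids_231_Cons) auto
    moreover have "path_edges (1 # c @ [Suc n]) = insert (1, n) (path_edges (n # A @ [Suc n]))"
      unfolding A(1) by simp
    moreover have "avoids_132 (path_edges (n # A @ [Suc n]))"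
      by (rule avoids_132_change_ends[OF A(5)]) (use A(3) in auto)
    \<comment> \<open>\<open>1\<close> is the smallest source, so the new edge could only be the 1
      of a 132. This takes two targets above \<open>n\<close>, and \<open>Suc n\<close> is the only
      one.\<close>
    then have "avoids_132 (insert (1, n) (path_edges (n # A @ [Suc n])))"
      using A(3) assms by (intro avoids_132_insert) (auto dest!: path_edges_in_set simp: butlast_append)
    ultimately show ?thesis using A assms by (auto simp: up_words_def)
  qed
qed

lemma down_words_Suc:
  assumes "n \<ge> 3"
  shows "down_words (Suc n) = (\<lambda>A. n # A) ` down_words n \<union> (\<lambda>A. A @ [n]) ` top_words n"
    (is "_ = ?R")
proof (intro equalityI subsetI)
  fix c assume "c \<in> down_words (Suc n)"
  then have c: "distinct c" "set c = {2..<Suc n}" "avoids_231 c"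
    "avoids_132 (path_edges (Suc n # c @ [1]))" by (auto simp: down_words_def)
  have "n \<in> set c" using c(2) assms by auto
  then obtain A B where ceq: "c = A @ n # B" by (metis split_list)
  have sub: "set A \<union> set B = {2..<n}"
    using c(1,2) unfolding ceq by (rule set_split_max)
  have rng: "2 \<le> x \<and> x < n" if "x \<in> set A \<or> x \<in> set B" for x
    using that sub by (metis UnI1 UnI2 atLeastLessThan_iff)
  have dis: "distinct A" "distinct B" "set A \<inter> set B = {}" using c(1) unfolding ceq by auto
  have path: "path_edges (Suc n # c @ [1]) = path_edges (Suc n # A @ [n]) \<union> path_edges (n # B @ [1])"
    unfolding ceq using path_edges_append[of "Suc n # A" n "B @ [1]"] by simp
  show "c \<in> ?R"
  proof (cases "A = [] \<or> B = []")
    case True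
    then show ?thesis
    proof
      assume A: "A = []"
      have "avoids_231 B" by (rule avoids_231_mono[OF c(3)]) (auto simp: ceq before_pairs_append)
      moreover have "avoids_132 (path_edges (n # B @ [1]))"
        by (rule avoids_132_mono[OF c(4)]) (unfold path, blast)
      ultimately show ?thesis using A sub dis by (auto simp: ceq down_words_def)
    next
      assume B: "B = []"
      have "avoids_231 A" by (rule avoids_231_mono[OF c(3)]) (auto simp: ceq before_pairs_append)
      moreover have "avoids_132 (path_edges (Suc n # A @ [n]))"
        by (rule avoids_132_mono[OF c(4)]) (unfold path, blast)
      then have "avoids_132 (path_edges (n # A @ [n]))"
        by (rule avoids_132_change_ends) (use rng in force)
      ultimately show ?thesis using B sub dis by (auto simp: ceq top_words_def)
    qed
  next
    case False
    have hdB: "hd A \<in> set A" "hd B \<in> set B" "last B \<in> set B" using False by simp_all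
    then have lt: "hd A < hd B"
      using avoids_231_split_max[OF c(3)[unfolded ceq] c(1)[unfolded ceq]] rng by blast
    \<comment> \<open>The start now lies above all other entries, so the triple differs from the one
      in \<open>not_avoids_132_split_max\<close>: the sources \<open>last B < n < Suc n\<close> have
      the targets \<open>1\<close>, \<open>hd B\<close>, \<open>hd A\<close>.\<close>
    have "(last B, 1) \<in> path_edges (Suc n # c @ [1])" "(n, hd B) \<in> path_edges (Suc n # c @ [1])"
      "(Suc n, hd A) \<in> path_edges (Suc n # c @ [1])"
      unfolding path using False by (auto simp: path_edges_Cons path_edges_snoc)
    from avoids_132D[OF c(4) this] show ?thesis using lt hdB rng by force
  qed
next
  fix c assume "c \<in> ?R"
  then show "c \<in> down_words (Suc n)"
  proof
    assume "c \<in> (\<lambda>A. n # A) ` down_words n"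
    then obtain A where A: "c = n # A" "distinct A" "set A = {2..<n}" "avoids_231 A"
      "avoids_132 (path_edges (n # A @ [1]))" by (auto simp: down_words_def)
    have "avoids_231 c" unfolding A(1) using A
      by (intro avoids_231_Cons) auto
    moreover have "path_edges (Suc n # c @ [1]) = insert (Suc n, n) (path_edges (n # A @ [1]))"
      unfolding A(1) by simp
    \<comment> \<open>\<open>Suc n\<close> is the largest source, so the new edge could only be the
      2 of a 132, but no target exceeds \<open>n\<close>.\<close>
    moreover have "avoids_132 (insert (Suc n, n) (path_edges (n # A @ [1])))"
      using A(3,5) assms by (intro avoids_132_insert) (auto dest!: path_edges_in_set simp: butlast_append)
    ultimately show ?thesis using A assms by (auto simp: down_words_def)
  next
    assume "c \<in> (\<lambda>A. A @ [n]) ` top_words n"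
    then obtain A where A: "c = A @ [n]" "distinct A" "set A = {2..<n}" "avoids_231 A"
      "avoids_132 (path_edges (n # A @ [n]))" by (auto simp: top_words_def)
    have "avoids_231 c" unfolding A(1) using A assms
      by (intro avoids_231_snoc) auto
    moreover have "path_edges (Suc n # c @ [1]) = insert (n, 1) (path_edges (Suc n # A @ [n]))"
      unfolding A(1) using path_edges_append[of "Suc n # A" n "[1]"] by simp
    moreover have "avoids_132 (path_edges (Suc n # A @ [n]))"
      by (rule avoids_132_change_ends[OF A(5)]) (use A(3) in auto)
    \<comment> \<open>\<open>1\<close> is the smallest target, so the new edge could only be the 1
      of a 132. This takes two sources above \<open>n\<close>, and \<open>Suc n\<close> is the only
      one.\<close>
    then have "avoids_132 (insert (n, 1) (path_edges (Suc n # A @ [n])))"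
      using A(3) assms by (intro avoids_132_insert) (auto dest!: path_edges_in_set simp: butlast_append)
    ultimately show ?thesis using A assms by (auto simp: down_words_def)
  qed
qed

section \<open>Words between two ends that lie above them\<close>

text \<open>The entries before 2 descend, since an ascent followed by 2 is a 231. If entries
  followed 2, every source below the last entry \<open>l\<close> would have a target at least the
  first entry \<open>a\<close>; but then \<open>a\<close> itself lies below \<open>l\<close> and is
  followed by something smaller.\<close>

lemma top_words_decreasing:
  assumes "A \<in> top_words n" "hd A \<noteq> 2" "n \<ge> 3"
  shows "A = rev [2..<n]"
proof -
  have A: "distinct A" "set A = {2..<n}" "avoids_231 A" "avoids_132 (path_edges (n # A @ [n]))"
    using assms(1) by (auto simp: top_words_def)
  have "2 \<in> set A" using A(2) assms(3) by auto
  then obtain D E where DE: "A = D @ 2 # E" by (metis split_list)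
  have D: "D \<noteq> []" using DE assms(2) by auto
  define a where "a = hd D"
  have aD: "a \<in> set D" using D by (simp add: a_def)
  have gt2: "2 < x" "x < n" if "x \<in> set D \<union> set E" for x
  proof -
    have "x \<in> {2..<n}" "x \<noteq> 2" using that A(1) unfolding A(2)[symmetric] DE by auto
    then show "2 < x" "x < n" by auto
  qed
  have D_dec: "y < x" if "(x, y) \<in> before_pairs D" for x y
  proof -
    have "x \<noteq> y" using that A(1) unfolding before_pairs_conv_nth DE
      by (auto simp: nth_eq_iff_index_eq)
    moreover have "\<not> (2 < x \<and> x < y)"
      using A(3) that before_pairs_in_set[OF that] unfolding avoids_231_def DE before_pairs_append by auto
    ultimately show ?thesis using gt2(1)[of x] before_pairs_in_set[OF that] by auto
  qed
  have edges: "path_edges (n # A @ [n]) = path_edges (n # D @ [2]) \<union> path_edges (2 # E @ [n])"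
    unfolding DE using path_edges_append[of "n # D" 2 "E @ [n]"] by simp
  have top: "(n, a) \<in> path_edges (n # A @ [n])"
    unfolding edges using D by (auto simp: path_edges_Cons a_def)
  have "E = []"
  proof (rule ccontr)
    assume E: "E \<noteq> []"
    define l e where "l = last E" and "e = hd E"
    have lE: "l \<in> set E" "e \<in> set E" using E by (simp_all add: l_def e_def)
    have ln: "(l, n) \<in> path_edges (n # A @ [n])" and e2: "(2, e) \<in> path_edges (n # A @ [n])"
      unfolding edges using E by (auto simp: path_edges_Cons path_edges_snoc l_def e_def)
    have "a < n" "l < n" using gt2(2) aD lE(1) by blast+
    \<comment> \<open>Otherwise the edges \<open>(x, y)\<close>, \<open>(l, n)\<close>,
      \<open>(n, a)\<close> form a 132.\<close>
    have large: "a \<le> y" if xy: "(x, y) \<in> path_edges (n # A @ [n])" "x < l" for x y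
    proof (rule ccontr)
      assume "\<not> a \<le> y"
      then show False
        using avoids_132D[OF A(4) xy(1) ln top xy(2) \<open>l < n\<close> _ \<open>a < n\<close>] by simp
    qed
    have "a \<noteq> e" using A(1) aD lE unfolding DE by auto
    then have ae: "a < e" using large[OF e2] gt2 lE by auto
    \<comment> \<open>If \<open>l\<close> differs from \<open>e\<close>, then \<open>a\<close>,
      \<open>e\<close>, \<open>l\<close> occur in this order with \<open>a < e\<close>, and must not
      form a 231.\<close>
    have "a \<le> l"
    proof (cases "l = e")
      case False
      then have "(e, l) \<in> before_pairs E" using lE E unfolding e_def l_def by (cases E) auto
      then have "(e, l) \<in> before_pairs A" "(a, e) \<in> before_pairs A"
        using aD lE unfolding DE by (simp_all add: before_pairs_append)
      then have "\<not> (l < a \<and> a < e)" using A(3) unfolding avoids_231_def by blast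
      then show ?thesis using ae by simp
    qed (use ae in simp)
    moreover have "a \<noteq> l" using A(1) aD lE unfolding DE by auto
    ultimately have al: "a < l" by simp
    obtain D' where D': "D = a # D'" using D by (cases D) (auto simp: a_def)
    \<comment> \<open>The successor of \<open>a\<close> is the next entry of \<open>D\<close>, or 2
      if \<open>D\<close> has no other entry.\<close>
    have "(a, hd (D' @ [2])) \<in> path_edges (n # A @ [n])"
      unfolding edges D' by (auto simp: path_edges_Cons)
    then have "a \<le> hd (D' @ [2])" using large al by blast
    moreover have "hd (D' @ [2]) < a"
      using D_dec gt2(1)[of a] aD unfolding D' by (cases D') auto
    ultimately show False by simp
  qed
  have "sorted_wrt (>) xs" if "\<And>x y. (x, y) \<in> before_pairs xs \<Longrightarrow> y < x" for xs :: "nat list"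
    using that by (induction xs) auto
  then have "sorted_wrt (>) D" using D_dec by blast
  then have "sorted_wrt (>) A" using gt2 unfolding DE \<open>E = []\<close> by (auto simp: sorted_wrt_append)
  then have "sorted_wrt (<) (rev A)" by (simp add: sorted_wrt_rev)
  then have "rev A = [2..<n]"
    using A(2) by (intro strict_sorted_equal) auto
  then show ?thesis by (metis rev_rev_ident)
qed

lemma path_edges_rev_upt: "path_edges (n # rev [k..<n]) = {(Suc j, j) | j. k \<le> j \<and> j < n}"
proof (induction n)
  case (Suc n)
  show ?case
  proof (cases "k \<le> n")
    case True
    then have "path_edges (Suc n # rev [k..<Suc n]) = insert (Suc n, n) {(Suc j, j) | j. k \<le> j \<and> j < n}"
      using Suc.IH by simp
    also have "\<dots> = {(Suc j, j) | j. k \<le> j \<and> j < Suc n}"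
      using True by (auto simp: less_Suc_eq)
    finally show ?thesis .
  qed simp
qed simp

text \<open>Apart from \<open>(2, n)\<close>, every edge goes down by one, so targets increase with
  sources. The edge \<open>(2, n)\<close> has the smallest source and the largest target, hence
  cannot be the 1 of a 132 and fits no other role.\<close>

lemma rev_upt_in_top_words:
  assumes "n \<ge> 3"
  shows "rev [2..<n] \<in> top_words n"
proof -
  have before: "y < x" if "(x, y) \<in> before_pairs (rev [2..<n])" for x y
    using that unfolding before_pairs_conv_nth by (auto simp: rev_nth)
  have "last (n # rev [2..<n]) = 2" using assms by (simp add: last_rev)
  then have edges: "path_edges (n # rev [2..<n] @ [n]) =
      insert (2, n) {(Suc j, j) | j. 2 \<le> j \<and> j < n}"
    using path_edges_snoc[of "n # rev [2..<n]" n] by (simp add: path_edges_rev_upt)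
  have "avoids_132 {(Suc j, j) | j. 2 \<le> j \<and> j < n}"
    unfolding avoids_132_def by auto
  then have "avoids_132 (path_edges (n # rev [2..<n] @ [n]))"
    unfolding edges by (rule avoids_132_insert) auto
  moreover have "avoids_231 (rev [2..<n])"
    unfolding avoids_231_def using before by (meson less_asym)
  ultimately show ?thesis by (simp add: top_words_def)
qed

text \<open>If the word starts with 2, the edge \<open>(Suc n, 2)\<close> has the largest source and
  the smallest target, so it takes part in no 132. The rest is a path from 1 to \<open>n\<close>
  with all labels raised by one.\<close>

lemma top_words_eq:
  assumes "n \<ge> 3"
  shows "top_words (Suc n) = insert (rev [2..<Suc n]) ((\<lambda>A. 2 # map Suc A) ` up_words n)"
    (is "_ = ?R")
proof (intro equalityI subsetI)
  fix c assume cT: "c \<in> top_words (Suc n)"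
  show "c \<in> ?R"
  proof (cases "hd c = 2")
    case False
    then show ?thesis using top_words_decreasing[OF cT] assms by auto
  next
    case True
    have c: "distinct c" "set c = {2..<Suc n}" "avoids_231 c"
      "avoids_132 (path_edges (Suc n # c @ [Suc n]))" using cT by (auto simp: top_words_def)
    then obtain B where B: "c = 2 # B" using True assms by (cases c) auto
    have "set B \<subseteq> set c" by (auto simp: B)
    then have "0 \<notin> set B" unfolding c(2) by (metis atLeastLessThan_iff not_numeral_le_zero subsetD)
    \<comment> \<open>As 0 does not occur in \<open>B\<close>, truncated subtraction inverts
      \<open>Suc\<close> here.\<close>
    define A where "A = map (\<lambda>x. x - 1) B"
    have "map (Suc \<circ> (\<lambda>x. x - 1)) B = B"
      using \<open>0 \<notin> set B\<close> by (intro map_idI) (metis Suc_pred' comp_apply neq0_conv)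
    then have BA: "B = map Suc A" unfolding A_def by simp
    have "Suc ` set A = set c - {2}" using c(1) unfolding B BA by auto
    also have "\<dots> = Suc ` {2..<n}" unfolding c(2) image_Suc_atLeastLessThan
      by (rule set_eqI, simp only: Diff_iff atLeastLessThan_iff singleton_iff, arith)
    finally have set: "set A = {2..<n}" by (simp only: inj_image_eq_iff inj_Suc)
    have "avoids_231 B" by (rule avoids_231_mono[OF c(3)]) (auto simp: B)
    then have "avoids_231 A" unfolding BA by (simp add: avoids_231_map_strict_mono strict_mono_Suc_iff)
    moreover have "avoids_132 (path_edges (2 # B @ [Suc n]))"
      by (rule avoids_132_mono[OF c(4)]) (auto simp: B)
    then have "avoids_132 (path_edges (map Suc (1 # A @ [n])))" by (simp add: BA numeral_2_eq_2)
    then have "avoids_132 (path_edges (1 # A @ [n]))"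
      unfolding path_edges_map by (simp add: avoids_132_map_strict_mono strict_mono_Suc_iff)
    moreover have "distinct A" using c(1) unfolding B BA by (simp add: distinct_map)
    ultimately have "A \<in> up_words n" using set by (simp add: up_words_def)
    then show ?thesis unfolding B BA by blast
  qed
next
  fix c assume "c \<in> ?R"
  then consider "c = rev [2..<Suc n]" | A where "A \<in> up_words n" "c = 2 # map Suc A" by blast
  then show "c \<in> top_words (Suc n)"
  proof cases
    case 1
    then show ?thesis using rev_upt_in_top_words[of "Suc n"] assms by simp
  next
    case 2
    then have A: "distinct A" "set A = {2..<n}" "avoids_231 A"
      "avoids_132 (path_edges (1 # A @ [n]))" by (auto simp: up_words_def)
    have "avoids_231 (map Suc A)" using A(3) by (simp add: avoids_231_map_strict_mono strict_mono_Suc_iff)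
    then have "avoids_231 c" unfolding 2 by (rule avoids_231_Cons) (use A(2) in auto)
    moreover have "avoids_132 (path_edges (map Suc (1 # A @ [n])))"
      unfolding path_edges_map using A(4) by (simp add: avoids_132_map_strict_mono strict_mono_Suc_iff)
    then have av: "avoids_132 (path_edges (2 # map Suc A @ [Suc n]))" by (simp add: numeral_2_eq_2)
    have "avoids_132 (insert (Suc n, 2) (path_edges (2 # map Suc A @ [Suc n])))"
      using av A(2) assms by (intro avoids_132_insert) (auto dest!: path_edges_in_set simp: butlast_append)
    then have "avoids_132 (path_edges (Suc n # c @ [Suc n]))" unfolding 2 by simp
    moreover have "set c = {2..<Suc n}"
    proof -
      have "set c = insert 2 (Suc ` {2..<n})" using A(2) by (simp add: 2)
      also have "\<dots> = {2..<Suc n}" using assms by auto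
      finally show ?thesis .
    qed
    moreover have "distinct c" unfolding 2 using A(1,2) by (auto simp: distinct_map)
    ultimately show ?thesis by (simp add: top_words_def)
  qed
qed

section \<open>Counting the words\<close>

lemma finite_words: "finite (up_words n)" "finite (down_words n)" "finite (top_words n)"
proof -
  have fin: "finite {A. set A \<subseteq> {2..<n} \<and> distinct A}"
    by (rule finite_subset_distinct) simp
  show "finite (up_words n)" unfolding up_words_def by (rule finite_subset[OF _ fin]) blast
  show "finite (down_words n)" unfolding down_words_def by (rule finite_subset[OF _ fin]) blast
  show "finite (top_words n)" unfolding top_words_def by (rule finite_subset[OF _ fin]) blast
qed

lemma words_3: "up_words 3 = {[2]}" "down_words 3 = {[2]}" "top_words 3 = {[2]}"
proof -
  have set: "{2..<3} = {2 :: nat}" by auto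
  have word: "distinct A \<and> set A = {2..<3} \<longleftrightarrow> A = [2]" for A :: "nat list"
  proof
    assume A: "distinct A \<and> set A = {2..<3}"
    then have "length A = Suc 0" using distinct_card[of A] by (simp add: set)
    then obtain a where "A = [a]" by (auto simp: length_Suc_conv)
    then show "A = [2]" using A by (simp add: set)
  qed (simp add: set)
  have eq: "{A. distinct A \<and> set A = {2..<3} \<and> avoids_231 A \<and> avoids_132 (path_edges (s # A @ [t]))} = {[2]}"
    if "avoids_132 (path_edges [s, 2, t])" for s t :: nat
  proof -
    have "avoids_231 [2]" by (simp add: avoids_231_def)
    then show ?thesis using that unfolding conj_assoc[symmetric] word by auto
  qed
  have "avoids_132 (path_edges [1, 2, 3])" "avoids_132 (path_edges [3, 2, 1])"
    "avoids_132 (path_edges [3, 2, 3])"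
    by (auto simp: avoids_132_def)
  then show "up_words 3 = {[2]}" "down_words 3 = {[2]}" "top_words 3 = {[2]}"
    unfolding up_words_def down_words_def top_words_def by (simp_all only: eq)
qed

text \<open>Keeps the two parts of each union disjoint: a nonempty \<open>A\<close> without
  \<open>n\<close> does not start with \<open>n\<close>, so \<open>A @ [n]\<close> is never of the
  form \<open>n # B\<close>.\<close>

lemma max_notin_words:
  assumes "A \<in> up_words n \<union> down_words n \<union> top_words n" "n \<ge> 3"
  shows "A \<noteq> []" "n \<notin> set A"
proof -
  have A: "set A = {2..<n}"
    using assms(1) by (auto simp: up_words_def down_words_def top_words_def)
  then have "2 \<in> set A" using assms(2) by simp
  then show "A \<noteq> []" by auto
  show "n \<notin> set A" by (simp add: A)
qed

lemma card_up_words_Suc: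
  assumes "n \<ge> 3"
  shows "card (up_words (Suc n)) = card (up_words n) + card (top_words n)"
proof -
  have "(\<lambda>A. A @ [n]) ` up_words n \<inter> (\<lambda>A. n # A) ` top_words n = {}"
  proof (rule ccontr)
    assume "\<not> ?thesis"
    then obtain A B where A: "A \<in> up_words n" and AB: "A @ [n] = n # B" by auto
    then show False using max_notin_words[of A n] assms by (cases A) auto
  qed
  then show ?thesis
    unfolding up_words_Suc[OF assms]
    by (simp add: card_Un_disjoint finite_words card_image inj_on_def)
qed

lemma card_down_words_Suc:
  assumes "n \<ge> 3"
  shows "card (down_words (Suc n)) = card (down_words n) + card (top_words n)"
proof -
  have "(\<lambda>A. n # A) ` down_words n \<inter> (\<lambda>A. A @ [n]) ` top_words n = {}"
  proof (rule ccontr)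
    assume "\<not> ?thesis"
    then obtain A B where A: "A \<in> top_words n" and AB: "n # B = A @ [n]" by auto
    then show False using max_notin_words[of A n] assms by (cases A) auto
  qed
  then show ?thesis
    unfolding down_words_Suc[OF assms]
    by (simp add: card_Un_disjoint finite_words card_image inj_on_def)
qed

lemma card_top_words_Suc:
  assumes "n \<ge> 3"
  shows "card (top_words (Suc n)) = Suc (card (up_words n))"
proof -
  \<comment> \<open>The head is \<open>n\<close>, which is at least 3.\<close>
  have "hd (rev [2..<Suc n]) \<noteq> 2" using assms by simp
  then have notin: "rev [2..<Suc n] \<notin> (\<lambda>A. 2 # map Suc A) ` up_words n"
    by (metis imageE list.sel(1))
  have "inj_on (\<lambda>A. 2 # map Suc A) (up_words n)"
    by (auto simp: inj_on_def dest: map_injective)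
  then show ?thesis
    unfolding top_words_eq[OF assms] card_insert_disjoint[OF finite_imageI[OF finite_words(1)] notin]
    by (simp only: card_image)
qed

lemma card_cycle_words:
  assumes "n \<ge> 3"
  shows "card (cycle_words n) = card (up_words n) + card (down_words n)"
proof -
  have "(\<lambda>A. 1 # A @ [n]) ` up_words n \<inter> (\<lambda>A. 1 # n # A) ` down_words n = {}"
  proof (rule ccontr)
    assume "\<not> ?thesis"
    then obtain A B where A: "A \<in> up_words n" and AB: "A @ [n] = n # B" by auto
    then show False using max_notin_words[of A n] assms by (cases A) auto
  qed
  then show ?thesis
    unfolding cycle_words_eq[OF assms]
    by (simp add: card_Un_disjoint finite_words card_image inj_on_def)
qed

text \<open>With u, d, t for the three cardinalities, the recurrences are u' = u + t, d' = d + t and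
  t' = u + 1. Thus u + 1 and d + 1 grow by the Fibonacci recurrence, with t as the preceding
  Fibonacci number.\<close>

lemma card_words_fib:
  assumes "n \<ge> 3"
  shows "Suc (card (up_words n)) = fib n \<and> Suc (card (down_words n)) = fib n \<and>
    card (top_words n) = fib (n - 1)"
  using assms
proof (induction n rule: nat_induct_at_least)
  case base
  have "fib 2 = 1" "fib 3 = 2" by (simp_all add: numeral_eq_Suc)
  then show ?case by (simp add: words_3)
next
  case (Suc n)
  \<comment> \<open>Turns \<open>n - 1\<close> into \<open>m\<close>, so that the recurrence of
    \<open>fib\<close> unfolds at \<open>Suc (Suc m)\<close>.\<close>
  then obtain m where m: "n = Suc m" by (cases n) auto
  show ?case
    using Suc card_up_words_Suc[of n] card_down_words_Suc[of n] card_top_words_Suc[of n]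
    by (simp add: m)
qed

section \<open>From permutations to words\<close>

text \<open>Three positions replace the choice function. Comparisons of an entry with itself hold
  trivially, which leaves six.\<close>

lemma contains_pattern_3:
  "contains_pattern w [s, t, u] \<longleftrightarrow>
    (\<exists>i j k. i < j \<and> j < k \<and> k < length w \<and>
       (w ! i < w ! j \<longleftrightarrow> s < t) \<and> (w ! j < w ! i \<longleftrightarrow> t < s) \<and>
       (w ! i < w ! k \<longleftrightarrow> s < u) \<and> (w ! k < w ! i \<longleftrightarrow> u < s) \<and>
       (w ! j < w ! k \<longleftrightarrow> t < u) \<and> (w ! k < w ! j \<longleftrightarrow> u < t))"
    (is "_ \<longleftrightarrow> ?R")
proof -
  have all_3: "(\<forall>a<3. P a) \<longleftrightarrow> P 0 \<and> P 1 \<and> P 2" for P :: "nat \<Rightarrow> bool"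
    by (auto simp: numeral_3_eq_3 numeral_2_eq_2 less_Suc_eq)
  have mono_3: "strict_mono_on {..<3} f \<longleftrightarrow> f 0 < f 1 \<and> f 1 < f 2" for f :: "nat \<Rightarrow> nat"
  proof -
    have "strict_mono_on {..<3} f \<longleftrightarrow> (\<forall>a<3. \<forall>b<3. a < b \<longrightarrow> f a < f b)"
      unfolding strict_mono_on_def by blast
    then show ?thesis unfolding all_3 by auto
  qed
  have len: "length [s, t, u] = 3" by simp
  have "contains_pattern w [s, t, u] \<longleftrightarrow>
    (\<exists>f :: nat \<Rightarrow> nat. f 0 < f 1 \<and> f 1 < f 2 \<and> f 2 < length w \<and>
       (w ! f 0 < w ! f 1 \<longleftrightarrow> s < t) \<and> (w ! f 1 < w ! f 0 \<longleftrightarrow> t < s) \<and>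
       (w ! f 0 < w ! f 2 \<longleftrightarrow> s < u) \<and> (w ! f 2 < w ! f 0 \<longleftrightarrow> u < s) \<and>
       (w ! f 1 < w ! f 2 \<longleftrightarrow> t < u) \<and> (w ! f 2 < w ! f 1 \<longleftrightarrow> u < t))"
    unfolding contains_pattern_def len all_3 mono_3
    by (intro ex_cong1) auto
  also have "\<dots> \<longleftrightarrow> ?R"
  proof
    assume ?R
    then obtain i j k where "i < j" "j < k" "k < length w"
      "w ! i < w ! j \<longleftrightarrow> s < t" "w ! j < w ! i \<longleftrightarrow> t < s" "w ! i < w ! k \<longleftrightarrow> s < u"
      "w ! k < w ! i \<longleftrightarrow> u < s" "w ! j < w ! k \<longleftrightarrow> t < u" "w ! k < w ! j \<longleftrightarrow> u < t" by blast
    then show "\<exists>f :: nat \<Rightarrow> nat. f 0 < f 1 \<and> f 1 < f 2 \<and> f 2 < length w \<and>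
       (w ! f 0 < w ! f 1 \<longleftrightarrow> s < t) \<and> (w ! f 1 < w ! f 0 \<longleftrightarrow> t < s) \<and>
       (w ! f 0 < w ! f 2 \<longleftrightarrow> s < u) \<and> (w ! f 2 < w ! f 0 \<longleftrightarrow> u < s) \<and>
       (w ! f 1 < w ! f 2 \<longleftrightarrow> t < u) \<and> (w ! f 2 < w ! f 1 \<longleftrightarrow> u < (t :: nat))"
      by (intro exI[of _ "(!) [i, j, k]"]) simp
  qed blast
  finally show ?thesis .
qed

lemma avoids_pattern_one_line:
  "avoids_pattern (one_line n p) [1, 3, 2] \<longleftrightarrow> avoids_132 {(x, p x) | x. x \<in> {1..n}}"
proof -
  \<comment> \<open>Lists are indexed from 0, while the permutation acts on numbers from 1.\<close>
  have nth: "one_line n p ! i = p (Suc i)" if "i < n" for i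
    using that by (simp add: one_line_def del: upt_Suc)
  have len: "length (one_line n p) = n" by (simp add: one_line_def)
  have "contains_pattern (one_line n p) [1, 3, 2] \<longleftrightarrow>
      (\<exists>i j k. i < j \<and> j < k \<and> k < n \<and> p (Suc i) < p (Suc k) \<and> p (Suc k) < p (Suc j))"
    unfolding contains_pattern_3 len
    by (intro ex_cong1) (auto simp: nth)
  also have "\<dots> \<longleftrightarrow> \<not> avoids_132 {(x, p x) | x. x \<in> {1..n}}"
  proof
    assume "\<exists>i j k. i < j \<and> j < k \<and> k < n \<and> p (Suc i) < p (Suc k) \<and> p (Suc k) < p (Suc j)"
    then obtain i j k where
      "i < j" "j < k" "k < n" "p (Suc i) < p (Suc k)" "p (Suc k) < p (Suc j)" by blast
    then show "\<not> avoids_132 {(x, p x) | x. x \<in> {1..n}}"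
      using avoids_132D[of "{(x, p x) | x. x \<in> {1..n}}" "Suc i" "p (Suc i)" "Suc j" "p (Suc j)"
          "Suc k" "p (Suc k)"] by auto
  next
    assume "\<not> avoids_132 {(x, p x) | x. x \<in> {1..n}}"
    then obtain x1 x2 x3 where x: "x1 \<in> {1..n}" "x2 \<in> {1..n}" "x3 \<in> {1..n}"
      "x1 < x2" "x2 < x3" "p x1 < p x3" "p x3 < p x2"
      unfolding avoids_132_def by auto
    then obtain i j k where "x1 = Suc i" "x2 = Suc j" "x3 = Suc k"
      by (cases x1; cases x2; cases x3) auto
    then have "i < j" "j < k" "k < n" "p (Suc i) < p (Suc k)" "p (Suc k) < p (Suc j)"
      using x by simp_all
    then show "\<exists>i j k. i < j \<and> j < k \<and> k < n \<and> p (Suc i) < p (Suc k) \<and> p (Suc k) < p (Suc j)"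
      by blast
  qed
  finally show ?thesis by blast
qed

lemma avoids_pattern_231:
  assumes "distinct w"
  shows "avoids_pattern w [2, 3, 1] \<longleftrightarrow> avoids_231 w"
proof -
  have "contains_pattern w [2, 3, 1] \<longleftrightarrow>
      (\<exists>i j k. i < j \<and> j < k \<and> k < length w \<and> w ! k < w ! i \<and> w ! i < w ! j)"
    unfolding contains_pattern_3 by (intro ex_cong1) auto
  then show ?thesis unfolding avoids_231_iff_nth[OF assms] by blast
qed

text \<open>Up to the first return time \<open>d\<close> to 1, the iterates run through the orbit of
  1 without repetition. This orbit is \<open>{1..n}\<close>, so counting gives
  \<open>d = n\<close>.\<close>

lemma cycle_notation_cyclic:
  assumes "cyclic_on p {1..n}"
  shows "distinct (cycle_notation n p)" "set (cycle_notation n p) = {1..n}" "(p ^^ n) 1 = 1"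
proof -
  have "1 \<in> {1..n}" using assms by (auto simp: cyclic_on_def)
  then have orb: "{1..n} = orbit p 1" and self: "1 \<in> orbit p 1"
    using assms by (auto simp: cyclic_on_alldef)
  define d where "d = funpow_dist1 p 1 1"
  have im: "{1..n} = (\<lambda>i. (p ^^ i) 1) ` {0..<d}"
    unfolding orb d_def by (rule orbit_conv_funpow_dist1[OF self])
  have inj: "inj_on (\<lambda>i. (p ^^ i) 1) {0..<d}"
    unfolding d_def by (rule inj_on_funpow_dist1[OF self])
  have "d = n" using card_image[OF inj] unfolding im[symmetric] by simp
  then show "distinct (cycle_notation n p)" "set (cycle_notation n p) = {1..n}"
    using inj im by (simp_all add: cycle_notation_def distinct_map)
  show "(p ^^ n) 1 = 1"
    using funpow_dist1_prop[OF self] \<open>d = n\<close> by (simp only: d_def)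
qed

text \<open>Since the \<open>n\<close>-th iterate returns to 1, the appended 1 is just the next
  iterate, and each edge leads from an entry to its image.\<close>

lemma path_edges_cycle_notation:
  assumes "cyclic_on p {1..n}"
  shows "path_edges (cycle_notation n p @ [1]) = {(x, p x) | x. x \<in> {1..n}}"
proof -
  have eq: "cycle_notation n p @ [1] = map (\<lambda>i. (p ^^ i) 1) [0..<Suc n]"
    using cycle_notation_cyclic(3)[OF assms] by (simp add: cycle_notation_def)
  then have nth: "(cycle_notation n p @ [1]) ! i = (p ^^ i) 1" if "i \<le> n" for i
    unfolding eq using that by (simp del: upt_Suc)
  have len: "length (cycle_notation n p @ [1]) = Suc n"
    by (simp add: cycle_notation_def)
  have "path_edges (cycle_notation n p @ [1]) = {((p ^^ i) 1, p ((p ^^ i) 1)) | i. i < n}"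
    unfolding path_edges_conv_nth len by (intro Collect_cong ex_cong1) (auto simp: nth simp del: One_nat_def)
  also have "\<dots> = {(x, p x) | x. x \<in> set (cycle_notation n p)}"
    by (auto simp: cycle_notation_def)
  finally show ?thesis unfolding cycle_notation_cyclic(2)[OF assms] .
qed

text \<open>Applying \<open>cycle_of_list c\<close> to all entries of \<open>c\<close> rotates the
  list, so the iterates of its first entry 1 read off \<open>c\<close>.\<close>

lemma cycle_notation_cycle_of_list:
  assumes c: "distinct c" "set c = {1..n}" "hd c = 1" and n: "n \<ge> 1"
  shows "cycle_notation n (cycle_of_list c) = c" "cyclic_on (cycle_of_list c) {1..n}"
proof -
  define p where "p = cycle_of_list c"
  have len: "length c = n" using distinct_card[OF c(1)] c(2) by simp
  then have c0: "c ! 0 = 1" using c(3) n by (metis hd_conv_nth length_0_conv not_one_le_zero)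
  have pow: "(p ^^ i) 1 = c ! (i mod n)" for i
  proof -
    have "(p ^^ i) (c ! 0) = map (p ^^ i) c ! 0" using len n by simp
    also have "\<dots> = c ! (i mod n)"
      unfolding p_def cyclic_rotation[OF c(1)] using len n by (simp add: nth_rotate)
    finally show ?thesis by (simp add: c0)
  qed
  show "cycle_notation n (cycle_of_list c) = c"
    unfolding p_def[symmetric] cycle_notation_def by (intro nth_equalityI) (simp_all add: pow len del: One_nat_def)
  have "orbit p 1 = {1..n}"
  proof
    show "orbit p 1 \<subseteq> {1..n}"
      unfolding orbit_altdef c(2)[symmetric] using n len
      by (auto simp: pow simp del: One_nat_def intro!: nth_mem mod_less_divisor)
    show "{1..n} \<subseteq> orbit p 1"
    proof
      fix x assume "x \<in> {1..n}"
      then obtain i where "i < n" "x = c ! i" unfolding c(2)[symmetric] by (auto simp: in_set_conv_nth len)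
      \<comment> \<open>An orbit consists of the iterates with positive exponent; adding the period
        \<open>n\<close> covers \<open>i = 0\<close>.\<close>
      then have "x = (p ^^ (i + n)) 1" by (simp only: pow) simp
      then show "x \<in> orbit p 1" unfolding orbit_altdef using n by auto
    qed
  qed
  then show "cyclic_on (cycle_of_list c) {1..n}"
    unfolding p_def[symmetric] cyclic_on_def using n by auto
qed

text \<open>The cycle notation determines the graph on \<open>{1..n}\<close>, and outside that set
  the permutation is the identity, whence injectivity. A preimage of \<open>c\<close> is
  \<open>cycle_of_list c\<close>; the two avoidance conditions translate separately.\<close>

lemma bij_betw_cycle_notation:
  assumes "n \<ge> 1"
  shows "bij_betw (cycle_notation n) (cyclic_avoiders n [1, 3, 2] [2, 3, 1]) (cycle_words n)"
proof (rule bij_betw_imageI)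
  show "inj_on (cycle_notation n) (cyclic_avoiders n [1, 3, 2] [2, 3, 1])"
  proof (rule inj_onI)
    fix p q
    assume "p \<in> cyclic_avoiders n [1, 3, 2] [2, 3, 1]" "q \<in> cyclic_avoiders n [1, 3, 2] [2, 3, 1]"
      and eq: "cycle_notation n p = cycle_notation n q"
    then have p: "p permutes {1..n}" "cyclic_on p {1..n}" and q: "q permutes {1..n}" "cyclic_on q {1..n}"
      by (simp_all add: cyclic_avoiders_def)
    have graph: "{(x, p x) | x. x \<in> {1..n}} = {(x, q x) | x. x \<in> {1..n}}"
      using path_edges_cycle_notation[OF p(2)] path_edges_cycle_notation[OF q(2)] eq by simp
    show "p = q"
    proof
      fix x
      show "p x = q x"
      proof (cases "x \<in> {1..n}")
        case True
        then have "(x, p x) \<in> {(x, q x) | x. x \<in> {1..n}}" unfolding graph[symmetric] by blast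
        then show ?thesis by simp
      next
        case False
        then show ?thesis using p(1) q(1) by (metis permutes_not_in)
      qed
    qed
  qed
  show "cycle_notation n ` cyclic_avoiders n [1, 3, 2] [2, 3, 1] = cycle_words n"
  proof (intro equalityI subsetI)
    fix c assume "c \<in> cycle_notation n ` cyclic_avoiders n [1, 3, 2] [2, 3, 1]"
    then obtain p where p: "cyclic_on p {1..n}" "avoids_pattern (one_line n p) [1, 3, 2]"
      "avoids_pattern c [2, 3, 1]" and c: "c = cycle_notation n p"
      by (auto simp: cyclic_avoiders_def)
    have "hd c = 1" unfolding c cycle_notation_def using assms by (simp add: hd_map)
    moreover have "avoids_231 c"
      using p(3) avoids_pattern_231 cycle_notation_cyclic(1)[OF p(1)] unfolding c by blast
    moreover have "avoids_132 (path_edges (c @ [1]))"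
      using p(2) unfolding c path_edges_cycle_notation[OF p(1)] avoids_pattern_one_line .
    ultimately show "c \<in> cycle_words n"
      using cycle_notation_cyclic[OF p(1)] by (simp add: cycle_words_def c)
  next
    fix c assume "c \<in> cycle_words n"
    then have c: "distinct c" "set c = {1..n}" "hd c = 1" "avoids_231 c"
      "avoids_132 (path_edges (c @ [1]))" by (simp_all add: cycle_words_def)
    note cyc = cycle_notation_cycle_of_list[OF c(1-3) assms]
    have "avoids_pattern (one_line n (cycle_of_list c)) [1, 3, 2]"
      using c(5) path_edges_cycle_notation[OF cyc(2)] unfolding avoids_pattern_one_line cyc(1) by simp
    moreover have "avoids_pattern (cycle_notation n (cycle_of_list c)) [2, 3, 1]"
      unfolding cyc(1) avoids_pattern_231[OF c(1)] by (rule c(4))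
    moreover have "cycle_of_list c permutes {1..n}" using cycle_permutes[of c] c(2) by simp
    ultimately have "cycle_of_list c \<in> cyclic_avoiders n [1, 3, 2] [2, 3, 1]"
      using cyc(2) by (simp add: cyclic_avoiders_def)
    then show "c \<in> cycle_notation n ` cyclic_avoiders n [1, 3, 2] [2, 3, 1]"
      using cyc(1) by (metis image_eqI)
  qed
qed

theorem theorem4p9:
  fixes n :: nat
  assumes "n \<ge> 3"
  shows "int (num_cyclic_avoiders n [1, 3, 2] [2, 3, 1]) = 2 * int (fib n) - 2"
proof -
  have "num_cyclic_avoiders n [1, 3, 2] [2, 3, 1] = card (cycle_words n)"
    unfolding num_cyclic_avoiders_def using bij_betw_cycle_notation[of n] assms
    by (intro bij_betw_same_card[of "cycle_notation n"]) simp
  \<comment> \<open>Both families have one element less than \<open>fib n\<close>.\<close>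
  then show ?thesis using card_cycle_words[OF assms] card_words_fib[OF assms] by simp
qed

end
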